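(* For every $z\in\mathbb{C}\setminus\{0,1\}$, the series $\sum_{n=0}^{\infty} v_n(z)$ converges and $$\xi(z)=\sum_{n=0}^{\infty} v_n(z),$$ where $v_0(z)=-\frac1z+\frac1{z-1}$ and, for every integer $n\ge 1$, $$v_n(z)=\frac{\Gamma\left(z/2,\pi n^2\right)}{(\pi n^2)^{z/2}}+\frac{\Gamma\left((1-z)/2,\pi n^2\right)}{(\pi n^2)^{(1-z)/2}}.$$
   Context: For $z\in\mathbb{C}\setminus\{0,1\}$, the Xi function in its symmetric form is $$\xi(z)=-\frac1z+\frac1{z-1}+\int_1^\infty\left(x^{z/2-1}+x^{-(z+1)/2}\right)\omega(x)\,dx,\qquad \omega(x)=\sum_{n=1}^\infty e^{-\pi n^2x}.$$ For $a>0$ and $w\in\mathbb{C}$, $\Gamma(w,a)=\int_a^\infty t^{w-1}e^{-t}\,dt$ is the upper incomplete gamma function, and $a^w=e^{w\ln a}$ with real logarithm. *)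

theory Defs
  imports "HOL-Analysis.Analysis"
begin

text \<open>
  For \<open>a > 0\<close> the improper integrals below converge absolutely, so they are rendered as Lebesgue integrals.
  For real \<open>x > 0\<close>, the principal branch \<open>complex_of_real x powr w\<close> equals
  \<open>exp (w * complex_of_real (ln x))\<close>, i.e. the power with real logarithm.
\<close>

definition upper_Gamma :: "complex \<Rightarrow> real \<Rightarrow> complex" where
  "upper_Gamma w a =
     (LINT t:{a..}|lborel. complex_of_real t powr (w - 1) * complex_of_real (exp (- t)))"

text \<open>The sum over \<open>n \<ge> 1\<close> is re-indexed by \<open>Suc n\<close>.\<close>

definition omega :: "real \<Rightarrow> real" where
  "omega x = (\<Sum>n. exp (- pi * (real (Suc n))\<^sup>2 * x))"

text \<open>Meaningful for \<open>z \<notin> {0, 1}\<close> only; elsewhere division by zero gives a junk value.\<close>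

definition xi :: "complex \<Rightarrow> complex" where
  "xi z = - (1 / z) + 1 / (z - 1) +
     (LINT x:{1..}|lborel.
        (complex_of_real x powr (z / 2 - 1) + complex_of_real x powr (- ((z + 1) / 2)))
          * complex_of_real (omega x))"

definition xi_term :: "nat \<Rightarrow> complex \<Rightarrow> complex" where
  "xi_term n z =
     (if n = 0 then - (1 / z) + 1 / (z - 1)
      else upper_Gamma (z / 2) (pi * (real n)\<^sup>2)
             / complex_of_real (pi * (real n)\<^sup>2) powr (z / 2)
         + upper_Gamma ((1 - z) / 2) (pi * (real n)\<^sup>2)
             / complex_of_real (pi * (real n)\<^sup>2) powr ((1 - z) / 2))"

end

theory Submission
  imports Defs
begin

text \<open>
  The identity is term-by-term integration. Write \<open>c = \<pi> n\<^sup>2\<close>. The substitution \<open>t = c x\<close> turns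
  \<open>\<Gamma>(w, c) / c\<^sup>w\<close> into the integral of \<open>x\<^sup>w\<^sup>-\<^sup>1 exp (- c x)\<close> over \<open>[1, \<infinity>)\<close>
  (lemma \<open>upper_Gamma_div_powr\<close>), so with \<open>w = z/2\<close> and \<open>w = (1 - z)/2\<close> the two halves of the
  \<open>n\<close>-th term become the integral of the kernel of \<open>\<xi>\<close> against the \<open>n\<close>-th summand of the theta
  series \<open>\<omega>\<close>.

  Sum and integral may be interchanged because on \<open>[1, \<infinity>)\<close> one has
  \<open>exp (- c x) \<le> exp (1 - c) exp (- x)\<close> for \<open>c \<ge> 1\<close> (lemma \<open>exp_neg_mult_le\<close>): the kernel times
  \<open>exp (- x)\<close> is integrable by comparison with the Gamma integral, and the numerical factors
  \<open>exp (1 - \<pi> n\<^sup>2)\<close> are summable by comparison with a geometric series.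
\<close>

lemma exp_neg_mult_le:
  fixes c x :: real
  assumes "1 \<le> c" "1 \<le> x"
  shows "exp (- c * x) \<le> exp (1 - c) * exp (- x)"
proof -
  have "0 \<le> (c - 1) * (x - 1)" using assms by simp
  then show ?thesis by (simp add: exp_add[symmetric] algebra_simps)
qed

text \<open>
  The principal logarithm jumps across the negative axis, so continuity does not give measurability
  on the whole line; its explicit form on each side of 0 does.
\<close>

lemma measurable_of_real_powr [measurable]:
  fixes s :: complex
  shows "(\<lambda>x. complex_of_real x powr s) \<in> borel_measurable borel"
proof -
  have "(\<lambda>x. complex_of_real x powr s) = (\<lambda>x. if x = 0 then 0
      else exp (s * (of_real (ln \<bar>x\<bar>) + (if x < 0 then of_real pi else 0) * \<i>)))"
    by (auto simp: powr_def Ln_of_real' fun_eq_iff)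
  then show ?thesis
    by simp
qed

text \<open>
  The exponent may have any real part: on \<open>[1, \<infinity>)\<close> it can be raised to a positive one, and then
  the integrand of Euler's Gamma integral over \<open>(0, \<infinity>)\<close> is a majorant.
\<close>

lemma set_integrable_powr_exp:
  fixes s :: complex and a :: real
  assumes "a > 0"
  shows "set_integrable lborel {1..} (\<lambda>x. complex_of_real x powr s * complex_of_real (exp (- a * x)))"
proof -
  define k where "k = complex_of_real (\<bar>Re s\<bar> + 1)"
  have "(\<lambda>t. complex_of_real t powr (k - 1) / of_real (exp (a * t))) absolutely_integrable_on {0<..}"
    by (rule absolutely_integrable_Gamma_integral) (use assms in \<open>auto simp: k_def\<close>)
  \<comment> \<open>absolute integrability refers to the completion of the Borel measure\<close>
  then have "set_integrable lborel {0<..}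
      (\<lambda>t. complex_of_real t powr (k - 1) / of_real (exp (a * t)))"
    unfolding set_integrable_def
    by (subst (asm) integrable_completion) measurable
  then have *: "set_integrable lborel {1..}
      (\<lambda>t. complex_of_real t powr (k - 1) / of_real (exp (a * t)))"
    by (rule set_integrable_subset) auto
  show ?thesis
    unfolding set_integrable_def
  proof (rule Bochner_Integration.integrable_bound[OF *[unfolded set_integrable_def]])
    show "AE x in lborel.
        norm (indicat_real {1..} x *\<^sub>R (complex_of_real x powr s * complex_of_real (exp (- a * x))))
      \<le> norm (indicat_real {1..} x *\<^sub>R (complex_of_real x powr (k - 1) / of_real (exp (a * x))))"
    proof (intro AE_I2)
      fix x :: real
      have "norm (complex_of_real x powr s) \<le> norm (complex_of_real x powr (k - 1))" if "1 \<le> x"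
        using that by (auto simp: norm_powr_real_powr k_def intro!: powr_mono)
      then show "norm (indicat_real {1..} x *\<^sub>R (complex_of_real x powr s * complex_of_real (exp (- a * x))))
        \<le> norm (indicat_real {1..} x *\<^sub>R (complex_of_real x powr (k - 1) / of_real (exp (a * x))))"
        by (auto simp: indicator_def norm_mult norm_divide exp_minus divide_inverse
            intro!: mult_right_mono)
    qed
  qed measurable
qed

text \<open>
  This is the substitution \<open>t = c x\<close>. It is an identity of integrals over the whole line of
  functions cut off by indicators, so convergence does not enter.
\<close>

lemma upper_Gamma_div_powr:
  fixes c :: real
  assumes "c > 0"
  shows "upper_Gamma w c / complex_of_real c powr w =
    (LINT x:{1..}|lborel. complex_of_real x powr (w - 1) * complex_of_real (exp (- c * x)))"
proof -
  let ?F = "\<lambda>t. indicat_real {c..} t *\<^sub>R (complex_of_real t powr (w - 1) * complex_of_real (exp (- t)))"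
  let ?G = "\<lambda>x. indicat_real {1..} x *\<^sub>R
              (complex_of_real x powr (w - 1) * complex_of_real (exp (- c * x)))"
  have scale: "c *\<^sub>R ?F (0 + c * x) = complex_of_real c powr w * ?G x" for x
  proof (cases "1 \<le> x")
    case True
    have "complex_of_real (c * x) powr (w - 1)
        = complex_of_real c powr (w - 1) * complex_of_real x powr (w - 1)"
      using assms True by (simp add: powr_times_real)
    moreover have "complex_of_real c * complex_of_real c powr (w - 1) = complex_of_real c powr w"
      using assms by (simp add: powr_diff)
    ultimately show ?thesis using assms True
      by (simp add: scaleR_conv_of_real mult_ac)
  next
    case False
    then show ?thesis using assms by (simp add: indicator_def)
  qed
  have "upper_Gamma w c = \<bar>c\<bar> *\<^sub>R (\<integral>x. ?F (0 + c * x) \<partial>lborel)"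
    unfolding upper_Gamma_def set_lebesgue_integral_def
    by (rule lborel_integral_real_affine) (use assms in auto)
  also have "\<dots> = (\<integral>x. c *\<^sub>R ?F (0 + c * x) \<partial>lborel)"
    using assms by (subst integral_scaleR_right) auto
  also have "\<dots> = (\<integral>x. complex_of_real c powr w * ?G x \<partial>lborel)"
    unfolding scale ..
  also have "\<dots> = complex_of_real c powr w * (\<integral>x. ?G x \<partial>lborel)"
    by (rule integral_mult_right_zero)
  finally show ?thesis
    using assms by (simp add: set_lebesgue_integral_def)
qed

definition xi_kernel :: "complex \<Rightarrow> real \<Rightarrow> complex" where
  "xi_kernel z x = complex_of_real x powr (z / 2 - 1) + complex_of_real x powr (- ((z + 1) / 2))"

lemma xi_kernel_measurable [measurable]: "xi_kernel z \<in> borel_measurable borel"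
  unfolding xi_kernel_def by measurable

lemma set_integrable_xi_kernel_exp:
  assumes "a > 0"
  shows "set_integrable lborel {1..} (\<lambda>x. xi_kernel z x * complex_of_real (exp (- a * x)))"
  using set_integral_add(1)[OF set_integrable_powr_exp[OF assms, of "z / 2 - 1"]
      set_integrable_powr_exp[OF assms, of "- ((z + 1) / 2)"]]
  by (simp add: xi_kernel_def distrib_right)

lemma norm_xi_kernel_exp_le:
  assumes "1 \<le> c"
  shows "norm (indicat_real {1..} x *\<^sub>R (xi_kernel z x * complex_of_real (exp (- c * x))))
    \<le> exp (1 - c) * norm (indicat_real {1..} x *\<^sub>R (xi_kernel z x * complex_of_real (exp (- x))))"
proof (cases "1 \<le> x")
  case True
  then show ?thesis
    using mult_left_mono[OF exp_neg_mult_le[OF assms True], of "norm (xi_kernel z x)"]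
    by (simp add: norm_mult mult_ac)
qed simp

lemma one_le_pi_Suc_sq: "1 \<le> pi * (real (Suc n))\<^sup>2"
proof -
  have "1 * 1 \<le> pi * (real (Suc n))\<^sup>2"
    using pi_gt3 by (intro mult_mono) auto
  then show ?thesis by simp
qed

lemma summable_theta:
  assumes "1 \<le> x"
  shows "summable (\<lambda>n. exp (- pi * (real (Suc n))\<^sup>2 * x))"
proof (rule summable_comparison_test')
  show "summable (\<lambda>n. exp (- 1 :: real) ^ n)"
    by (rule summable_geometric) simp
  fix n :: nat
  have "real n \<le> 1 * (real (Suc n))\<^sup>2 * 1"
    by (simp add: power2_eq_square algebra_simps)
  also have "\<dots> \<le> pi * (real (Suc n))\<^sup>2 * x"
    using assms pi_gt3 by (intro mult_mono) auto
  finally show "norm (exp (- pi * (real (Suc n))\<^sup>2 * x)) \<le> exp (- 1) ^ n"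
    by (simp add: exp_of_nat_mult[symmetric])
qed

lemma xi_term_Suc:
  "xi_term (Suc n) z =
    (LINT x:{1..}|lborel. xi_kernel z x * complex_of_real (exp (- (pi * (real (Suc n))\<^sup>2) * x)))"
proof -
  let ?c = "pi * (real (Suc n))\<^sup>2"
  have c: "?c > 0" by simp
  have "xi_term (Suc n) z =
      (LINT x:{1..}|lborel. complex_of_real x powr (z / 2 - 1) * complex_of_real (exp (- ?c * x))) +
      (LINT x:{1..}|lborel. complex_of_real x powr ((1 - z) / 2 - 1) * complex_of_real (exp (- ?c * x)))"
    unfolding xi_term_def upper_Gamma_div_powr[OF c] by simp
  also have "(1 - z) / 2 - 1 = - ((z + 1) / 2)"
    by (simp add: field_simps)
  finally show ?thesis
    unfolding xi_kernel_def distrib_right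
    by (simp only: set_integral_add(2)[OF set_integrable_powr_exp[OF c] set_integrable_powr_exp[OF c]])
qed

lemma xi_term_Suc_sums:
  "(\<lambda>n. xi_term (Suc n) z) sums
    (LINT x:{1..}|lborel. xi_kernel z x * complex_of_real (omega x))"
proof -
  define c where "c n = pi * (real (Suc n))\<^sup>2" for n
  define f where "f n x = indicat_real {1..} x *\<^sub>R
      (xi_kernel z x * complex_of_real (exp (- c n * x)))" for n x
  have c: "1 \<le> c n" for n
    unfolding c_def by (rule one_le_pi_Suc_sq)
  have int: "integrable lborel (f n)" for n
    using set_integrable_xi_kernel_exp[OF less_le_trans[OF zero_less_one c]] by (simp add: f_def[abs_def] set_integrable_def)
  have f_sums: "(\<lambda>n. f n x) sums
      (indicat_real {1..} x *\<^sub>R (xi_kernel z x * complex_of_real (omega x)))" for x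
  proof (cases "1 \<le> x")
    case True
    then have "(\<lambda>n. exp (- c n * x)) sums omega x"
      unfolding omega_def c_def using summable_sums[OF summable_theta[OF True]] by simp
    then show ?thesis
      unfolding f_def by (intro sums_scaleR_right sums_mult sums_of_real)
  qed (simp add: f_def)
  have norm_summable: "summable (\<lambda>n. norm (f n x))" for x
  proof (cases "1 \<le> x")
    case True
    then show ?thesis
      using summable_mult[OF summable_theta[OF True], of "norm (xi_kernel z x)"]
      by (simp add: f_def norm_mult c_def)
  qed (simp add: f_def)
  define K where
    "K = (\<integral>x. norm (indicat_real {1..} x *\<^sub>R (xi_kernel z x * complex_of_real (exp (- x)))) \<partial>lborel)"
  have bound: "(\<integral>x. norm (f n x) \<partial>lborel) \<le> exp (1 - c n) * K" for n
  proof -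
    have "(\<integral>x. norm (f n x) \<partial>lborel) \<le> (\<integral>x. exp (1 - c n) *
        norm (indicat_real {1..} x *\<^sub>R (xi_kernel z x * complex_of_real (exp (- x)))) \<partial>lborel)"
      using set_integrable_xi_kernel_exp[of 1] int norm_xi_kernel_exp_le[OF c]
      unfolding set_integrable_def f_def
      by (intro integral_mono integrable_mult_right integrable_norm) auto
    then show ?thesis by (simp add: K_def)
  qed
  have "summable (\<lambda>n. exp 1 * K * exp (- pi * (real (Suc n))\<^sup>2 * 1))"
    by (intro summable_mult summable_theta) simp
  then have "summable (\<lambda>n. exp (1 - c n) * K)"
    by (simp add: c_def exp_diff exp_minus divide_inverse mult_ac)
  then have "summable (\<lambda>n. \<integral>x. norm (f n x) \<partial>lborel)"
    by (rule summable_comparison_test') (use bound in auto)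
  then have "(\<lambda>n. integral\<^sup>L lborel (f n)) sums (\<integral>x. (\<Sum>n. f n x) \<partial>lborel)"
    by (intro sums_integral int AE_I2 norm_summable)
  then show ?thesis
    unfolding xi_term_Suc set_lebesgue_integral_def sums_unique[OF f_sums, symmetric]
    by (simp add: f_def[abs_def] c_def)
qed

theorem mainTheorem1:
  fixes z :: complex
  assumes "z \<notin> {0, 1}"
  shows "summable (\<lambda>n. xi_term n z) \<and> xi z = (\<Sum>n. xi_term n z)"
proof -
  have "(\<lambda>n. xi_term n z) sums
      ((LINT x:{1..}|lborel. xi_kernel z x * complex_of_real (omega x)) + xi_term 0 z)"
    using xi_term_Suc_sums by (rule sums_Suc)
  also have "(LINT x:{1..}|lborel. xi_kernel z x * complex_of_real (omega x)) + xi_term 0 z = xi z"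
    by (simp add: xi_def xi_term_def xi_kernel_def)
  finally show ?thesis
    by (simp add: sums_iff)
qed

end
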